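(* For every integer $r$, the largest positive integer $m$ for which $N_{r,m}$ is non-empty exists, and, denoting it by $m_{\max}(r)$, $$m_{\max}(r)=\begin{cases}2 & \text{if } r=0,\\ 3 & \text{if } |r|=1,\\ 4 & \text{if } |r|=2,\\ |r| & \text{if } |r|\ge 3.\end{cases}$$
   Context: $\mathbb{N}$ is the set of positive integers. For $u\in\mathbb{Z}[x]$ and $n\in\mathbb{N}$, $u^{(n)}$ denotes the $n$-fold composition $u\circ\cdots\circ u$. For $r\in\mathbb{Z}$, $u$ is called nilpotent at $r$ if there is $n\in\mathbb{N}$ with $u^{(n)}(r)=0$; the smallest such $n$ is called the index of $u$ at $r$. $N_{r,m}$ denotes the set of all $u\in\mathbb{Z}[x]$ that are nilpotent at $r$ of index $m$. *)

theory Defs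
  imports "HOL-Computational_Algebra.Polynomial"
begin

definition poly_iterate :: "int poly \<Rightarrow> nat \<Rightarrow> int poly" where
  "poly_iterate u n = ((\<lambda>p. pcompose u p) ^^ n) [:0, 1:]"

definition nilpotent_at :: "int poly \<Rightarrow> int \<Rightarrow> bool" where
  "nilpotent_at u r \<longleftrightarrow> (\<exists>n>0. poly (poly_iterate u n) r = 0)"

text \<open>Meaningful only if \<open>u\<close> is nilpotent at \<open>r\<close>.\<close>

definition nilpotency_index :: "int poly \<Rightarrow> int \<Rightarrow> nat" where
  "nilpotency_index u r = (LEAST n. n > 0 \<and> poly (poly_iterate u n) r = 0)"

definition nilpotent_polys :: "int \<Rightarrow> nat \<Rightarrow> int poly set" where
  "nilpotent_polys r m = {u. nilpotent_at u r \<and> nilpotency_index u r = m}"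

text \<open>\<open>GREATEST\<close> is unspecified if there is no largest such \<open>m\<close>, so existence of the
  maximum has to be asserted separately.\<close>

definition m_max :: "int \<Rightarrow> nat" where
  "m_max r = (GREATEST m. m > 0 \<and> nilpotent_polys r m \<noteq> {})"

end

theory Submission
  imports Defs
begin

text \<open>
  Along an orbit \<open>r = a 0, a 1, \<dots>, a m = 0\<close> of an integer polynomial, \<open>a i - a j\<close> divides
  \<open>a (i + 1) - a (j + 1)\<close>. Hence each step divides all later steps and all later values, and
  every tail of the orbit, divided by its first step, is a sequence of the same kind with first
  step \<open>1\<close>. Let such a normalised sequence start with \<open>k\<close> unit steps followed by a step \<open>t \<noteq> 1\<close>.
  Then \<open>1, \<dots>, k\<close> all divide \<open>t - 1\<close>, so \<open>t\<close> is large, and the remaining tail starts, after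
  rescaling, at \<open>(a 0 + k) div t\<close>. Induction on the length bounds the length in terms of \<open>a 0\<close>,
  apart from a few small starting values that are excluded by looking one or two steps further.
\<close>

section \<open>Sequences with the divisibility property of integer polynomial orbits\<close>

text \<open>Indices are bounded by \<open>m\<close>, so only values up to \<open>a m\<close> matter
  and the property passes to tails and to quotients that are exact only there.\<close>

definition nil_orbit :: "(nat \<Rightarrow> int) \<Rightarrow> nat \<Rightarrow> bool" where
  "nil_orbit a m \<longleftrightarrow> a m = 0 \<and> (\<forall>i<m. a i \<noteq> 0) \<and>
     (\<forall>i<m. \<forall>j<m. a i - a j dvd a (Suc i) - a (Suc j))"

lemma nil_orbit_end: "nil_orbit a m \<Longrightarrow> a m = 0"
  and nil_orbit_nonzero: "nil_orbit a m \<Longrightarrow> i < m \<Longrightarrow> a i \<noteq> 0"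
  and nil_orbit_dvd:
    "nil_orbit a m \<Longrightarrow> i < m \<Longrightarrow> j < m \<Longrightarrow> a i - a j dvd a (Suc i) - a (Suc j)"
  by (auto simp: nil_orbit_def)

text \<open>After a repetition both positions evolve alike, since \<open>0\<close> divides only
  \<open>0\<close>; the earlier one would then reach \<open>0\<close> before index
  \<open>m\<close>.\<close>

lemma nil_orbit_no_repeat:
  assumes "nil_orbit a m" "i < j" "j \<le> m"
  shows "a i \<noteq> a j"
proof
  assume eq: "a i = a j"
  have "a (i + n) = a (j + n)" if "j + n \<le> m" for n
    using that
  proof (induction n)
    case 0
    then show ?case using eq by simp
  next
    case (Suc n)
    then show ?case
      using nil_orbit_dvd[OF assms(1), of "i + n" "j + n"] assms(2) by simp
  qed
  from this[of "m - j"] have "a (i + (m - j)) = 0"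
    using assms nil_orbit_end by simp
  moreover have "i + (m - j) < m" using assms by simp
  ultimately show False using nil_orbit_nonzero[OF assms(1)] by blast
qed

lemma nil_orbit_step_dvd:
  assumes "nil_orbit a m" "k \<le> j" "j < m"
  shows "a (Suc k) - a k dvd a (Suc j) - a j"
  using assms(2,3)
proof (induction j rule: dec_induct)
  case (step n)
  then show ?case
    using nil_orbit_dvd[OF assms(1), of "Suc n" n] by (meson Suc_lessD dvd_trans)
qed simp

text \<open>Backward induction from \<open>a m = 0\<close>: going down one index subtracts a later
  step, which the given step divides.\<close>

lemma nil_orbit_step_dvd_value:
  assumes "nil_orbit a m" "k < m" "k \<le> j" "j \<le> m"
  shows "a (Suc k) - a k dvd a j"
  using assms(4,3)
proof (induction j rule: inc_induct)
  case base
  then show ?case using nil_orbit_end[OF assms(1)] by simp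
next
  case (step n)
  have "a (Suc k) - a k dvd a (Suc n)" using step by simp
  moreover have "a (Suc k) - a k dvd a (Suc n) - a n"
    using nil_orbit_step_dvd[OF assms(1)] step by simp
  ultimately have "a (Suc k) - a k dvd a (Suc n) - (a (Suc n) - a n)" by (rule dvd_diff)
  then show ?case by simp
qed

lemma nil_orbit_shift:
  assumes "nil_orbit a m" "k \<le> m"
  shows "nil_orbit (\<lambda>i. a (k + i)) (m - k)"
  unfolding nil_orbit_def
proof (intro conjI allI impI)
  show "a (k + (m - k)) = 0" using assms nil_orbit_end by simp
  show "a (k + i) \<noteq> 0" if "i < m - k" for i
    using nil_orbit_nonzero[OF assms(1), of "k + i"] that by simp
  show "a (k + i) - a (k + j) dvd a (k + Suc i) - a (k + Suc j)" if "i < m - k" "j < m - k" for i j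
    using nil_orbit_dvd[OF assms(1), of "k + i" "k + j"] that by simp
qed

lemma nil_orbit_unscale:
  assumes "nil_orbit a m" "t \<noteq> 0" "\<And>i. i \<le> m \<Longrightarrow> a i = t * b i"
  shows "nil_orbit b m"
  unfolding nil_orbit_def
proof (intro conjI allI impI)
  show "b m = 0" using assms(1,2) assms(3)[of m] nil_orbit_end by force
  show "b i \<noteq> 0" if "i < m" for i
    using nil_orbit_nonzero[OF assms(1) that] assms(3)[of i] that by auto
  show "b i - b j dvd b (Suc i) - b (Suc j)" if "i < m" "j < m" for i j
    using nil_orbit_dvd[OF assms(1) that] assms(2) assms(3)[of i] assms(3)[of j]
      assms(3)[of "Suc i"] assms(3)[of "Suc j"] that
    by (simp flip: right_diff_distrib)
qed

text \<open>Normalises the tail from index \<open>k\<close> to first step \<open>1\<close>; the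
  division by \<open>t\<close> is exact because a step divides all values from its index on.\<close>

lemma nil_orbit_rescale:
  assumes "nil_orbit a m" "k < m"
  obtains t b where "t \<noteq> 0" "t = a (Suc k) - a k" "\<And>i. i \<le> m - k \<Longrightarrow> a (k + i) = t * b i"
    "b 1 = b 0 + 1" "nil_orbit b (m - k)"
proof -
  define t where "t = a (Suc k) - a k"
  define b where "b = (\<lambda>i. a (k + i) div t)"
  have t0: "t \<noteq> 0" using nil_orbit_no_repeat[OF assms(1), of k "Suc k"] assms(2)
    by (simp add: t_def)
  have ab: "a (k + i) = t * b i" if "i \<le> m - k" for i
    using nil_orbit_step_dvd_value[OF assms, of "k + i"] that assms(2)
    by (simp add: t_def b_def)
  have "t * b 1 - t * b 0 = t"
    using ab[of 0] ab[of 1] assms(2) by (simp add: t_def)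
  then have "t * (b 1 - b 0) = t * 1" by (simp add: algebra_simps)
  then have b1: "b 1 = b 0 + 1" using t0 by simp
  have "nil_orbit b (m - k)"
    by (rule nil_orbit_unscale[OF nil_orbit_shift[OF assms(1)] t0]) (use assms ab in auto)
  with that[OF t0 t_def ab b1] show ?thesis by blast
qed

section \<open>Length bound for a non-zero start\<close>

lemma dvd_2_cases: "x dvd (2::int) \<Longrightarrow> x \<in> {-2,-1,1,2}"
proof -
  assume d: "x dvd 2"
  then have "\<bar>x\<bar> \<le> 2" "x \<noteq> 0" using dvd_imp_le_int[of 2 x] by auto
  then show ?thesis by auto
qed

lemma dvd_3_cases: "x dvd (3::int) \<Longrightarrow> x \<in> {-3,-1,1,3}"
proof -
  assume d: "x dvd 3"
  then have "\<bar>x\<bar> \<le> 3" "x \<noteq> 0" using dvd_imp_le_int[of 3 x] by auto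
  then have "x \<in> {-3,-2,-1,1,2,3}" by auto
  then show ?thesis using d by auto
qed

text \<open>Divisibility forces such an orbit to go on \<open>A - 1, A, 2A, 4A\<close> with \<open>A = 2\<close>, and its tail
  is again of this kind up to scaling.\<close>

lemma nil_orbit_no_doubling:
  assumes "nil_orbit a m" "a 0 = A - 1" "a 1 = A" "a 2 = 2 * A" "A \<ge> 2" "m \<ge> 2"
  shows False
  using assms
proof (induction m arbitrary: a A rule: less_induct)
  case (less m)
  note orb = less.prems(1)
  have "m \<noteq> 2" using nil_orbit_end[OF orb] less.prems by auto
  then have m: "m > 2" and "2 \<le> m - 1" using less.prems by simp_all
  obtain t b where tb: "t \<noteq> 0" "t = a (Suc 1) - a 1"
    "\<And>i. i \<le> m - 1 \<Longrightarrow> a (1 + i) = t * b i" "b 1 = b 0 + 1" "nil_orbit b (m - 1)"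
    using nil_orbit_rescale[OF orb, of 1] m by (metis One_nat_def Suc_lessD numeral_2_eq_2)
  have t: "t = A" using tb(2) less.prems by (simp add: numeral_2_eq_2)
  have b0: "b 0 = 1" using tb(3)[of 0] t less.prems tb(1) by auto
  have b1: "b 1 = 2" using b0 tb(4) by simp
  have "b 2 - b 1 dvd b 1"
    using nil_orbit_step_dvd_value[OF tb(5), of 1 1] m by (simp add: numeral_2_eq_2)
  then have "b 2 - 2 \<in> {-2,-1,1,2}" using dvd_2_cases[of "b 2 - 2"] b1 by simp
  moreover have "b 2 \<noteq> b 0" using nil_orbit_no_repeat[OF tb(5), of 0 2] m by fastforce
  ultimately have y: "b 2 \<in> {0,3,4}" using b0 by auto
  \<comment> \<open>The left side is \<open>A + 1\<close>, the right side
    \<open>A * (b 2 - 1)\<close>.\<close>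
  have "a 2 - a 0 dvd a 3 - a 1"
    using nil_orbit_dvd[OF orb, of 2 0] m by (simp add: numeral_3_eq_3)
  moreover have "a 3 = A * b 2"
    using tb(3)[of 2, OF \<open>2 \<le> m - 1\<close>] t by (simp add: numeral_3_eq_3)
  ultimately have "A + 1 dvd (b 2 - 1) * A" using less.prems by (simp add: algebra_simps)
  moreover have "coprime (A + 1) A" by simp
  ultimately have dv: "A + 1 dvd b 2 - 1" using coprime_dvd_mult_left_iff by blast
  have "b 2 - 1 \<noteq> 0" using y by auto
  then have "\<bar>A + 1\<bar> \<le> \<bar>b 2 - 1\<bar>" using dvd_imp_le_int[OF _ dv] by blast
  \<comment> \<open>As \<open>A + 1 \<ge> 3\<close>, of the three candidates only \<open>4\<close>
    remains, so \<open>b\<close> starts \<open>1, 2, 4\<close>.\<close>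
  then have "b 2 = 4" using y less.prems(5) by auto
  then show False
    using less.IH[of "m - 1" b 2] tb(5) b0 b1 m \<open>2 \<le> m - 1\<close> by simp
qed

text \<open>The bound depends on the sign, since for normalised sequences the first step is \<open>+1\<close>: it
  leads towards \<open>0\<close> exactly if the start is negative.\<close>

definition orbit_bound :: "int \<Rightarrow> int" where
  "orbit_bound x = (if x < 0 then - x else if x = 1 then 3 else if x = 2 then 4 else x)"

text \<open>Induction step for \<open>k\<close> unit steps from \<open>x\<close>, followed by a step \<open>t\<close>; \<open>q\<close> is the start and
  \<open>l\<close> the length of the rescaled tail.\<close>

lemma orbit_bound_step:
  fixes x k t q l :: int
  assumes eq: "x + k = t * q" and k: "k \<ge> 1" and t: "t \<notin> {-1, 0, 1}" and q: "q \<noteq> 0"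
    and x: "x \<noteq> 0" "x < 0 \<Longrightarrow> x + k < 0"
    and d2: "k \<ge> 2 \<Longrightarrow> 2 dvd t - 1" and d3: "k \<ge> 3 \<Longrightarrow> 3 dvd t - 1"
    and d4: "k \<ge> 4 \<Longrightarrow> 3 * k \<le> \<bar>t - 1\<bar>"
    and l: "l \<le> orbit_bound q"
    and ex1: "\<not> (q = 1 \<and> t \<ge> 2)"
    and ex2: "\<not> (q = 2 \<and> t = 2 \<and> k = 1)"
    and ex3: "\<not> (q = 2 \<and> t = 3 \<and> k = 2)"
    and ex4: "q = 1 \<Longrightarrow> t = - 2 \<Longrightarrow> k = 1 \<Longrightarrow> l \<le> 2"
  shows "k + l \<le> orbit_bound x"
proof -
  have k_cases: "k = 1 \<or> k = 2 \<or> k = 3 \<or> k \<ge> 4" using k by linarith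
  have t2: "t \<ge> 2 \<or> t \<le> -2" using t by auto
  show ?thesis
  proof (cases "x < 0")
    case True
    then have neg: "t * q < 0" using x(2) eq by simp
    \<comment> \<open>Since \<open>- (t * q) = - x - k\<close>, this is the claim for negative
      \<open>x\<close>.\<close>
    have "l \<le> - (t * q)"
    proof (cases "q < 0")
      case True
      then have "t > 0" using neg by (simp add: mult_less_0_iff)
      then have "t * q \<le> q" using True mult_right_mono_neg[of 1 t q] by simp
      moreover have "l \<le> - q" using l True by (simp add: orbit_bound_def)
      ultimately show ?thesis by linarith
    next
      case False
      then have t': "t \<le> -2" using neg q t2 by (auto simp: mult_less_0_iff)
      consider "q = 1" | "q = 2" | "q \<ge> 3" using False q by linarith
      then show ?thesis
      proof cases
        case 1
        \<comment> \<open>For \<open>q = 1\<close> the bound on \<open>l\<close> is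
          \<open>3\<close>, too weak only for \<open>t = -2\<close>. There \<open>t - 1\<close> is
          odd, so \<open>k = 1\<close> and \<open>ex4\<close> improves the bound to
          \<open>2\<close>.\<close>
        have "k = 1" if "t = -2" using that k_cases d2 d3 d4 by auto
        then show ?thesis using 1 l ex4 t' by (cases "t = -2") (auto simp: orbit_bound_def)
      next
        case 2
        then show ?thesis using l t' by (simp add: orbit_bound_def)
      next
        case 3
        then have "t * q \<le> - q" using t' mult_right_mono[of t "- 1" q] by simp
        moreover have "l \<le> q" using l 3 by (simp add: orbit_bound_def)
        ultimately show ?thesis by linarith
      qed
    qed
    then show ?thesis using True eq by (simp add: orbit_bound_def)
  next
    case False
    then have pos: "t * q > 0" using eq k by simp
    show ?thesis
    proof (cases "q < 0")
      case True
      then have t': "t \<le> -2" using pos t2 by (auto simp: zero_less_mult_iff)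
      have lq: "l \<le> - q" using l True by (simp add: orbit_bound_def)
      have ge: "orbit_bound x \<ge> x" "orbit_bound x \<ge> 3" using False x(1)
        by (auto simp: orbit_bound_def)
      have mono: "t * q \<ge> c * (- q)" if "t \<le> - c" for c
        using mult_right_mono_neg[of t "- c" q] that True by simp
      consider "k = 1" | "k = 2" | "k = 3" | "k \<ge> 4" using k_cases by blast
      then show ?thesis
      proof cases
        case 1
        then show ?thesis using ge eq lq mono[of 2] t' True by (cases "q = -1") auto
      next
        case 2
        then have "t \<le> -3" using d2 t' by presburger
        then show ?thesis using 2 ge eq lq mono[of 3] True by (cases "q = -1") auto
      next
        case 3
        then have t5: "t = -5 \<or> t \<le> -7" using d2 d3 t' by presburger
        show ?thesis
        proof (cases "q = -1")
          case True
          \<comment> \<open>\<open>x = 3\<close> would allow only length \<open>3\<close>, but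
            \<open>k + l\<close> may be \<open>4\<close>.\<close>
          then have "x = 2 \<or> x \<ge> 4" using t5 3 eq by auto
          then show ?thesis using True 3 ge lq by (auto simp: orbit_bound_def)
        next
          case False
          then have "q \<le> -2" using True by simp
          moreover have "t * q \<ge> 5 * (- q)" using mono[of 5] t5 by auto
          ultimately show ?thesis using 3 ge eq lq by linarith
        qed
      next
        case 4
        then have "t \<le> - (2 * k + 1)" using d4 t' by linarith
        \<comment> \<open>The two products add up to \<open>t * q + q - 2 * k\<close>, whence
          \<open>x = t * q - k \<ge> k - q\<close>.\<close>
        then have "(- t - 1 - 2 * k) * (- q) \<ge> 0" "(2 * k) * (- q - 1) \<ge> 0"
          using True k by (auto intro!: mult_nonneg_nonneg simp del: mult_minus_right)
        then show ?thesis using ge eq lq by (simp add: algebra_simps)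
      qed
    next
      case F: False
      then have t': "t \<ge> 2" using pos t2 by (auto simp: zero_less_mult_iff)
      have ge: "orbit_bound x \<ge> x" using False by (auto simp: orbit_bound_def)
      have q2: "q \<ge> 2" using F q ex1 t' by auto
      then have mono: "t * q \<ge> c * q" if "t \<ge> c" for c
        using mult_right_mono[of c t q] that by simp
      have lq: "l \<le> (if q = 2 then 4 else q)" using l q2 by (simp add: orbit_bound_def)
      show ?thesis
      proof (cases "q = 2")
        case True
        \<comment> \<open>Here \<open>2 * t - k \<ge> k + 4\<close> is needed; \<open>ex2\<close>
          and \<open>ex3\<close> remove the cases where it fails.\<close>
        then have x: "x = 2 * t - k" "l \<le> 4" using eq lq by auto
        consider "k = 1" | "k = 2" | "k = 3" | "k \<ge> 4" using k_cases by blast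
        then show ?thesis
        proof cases
          case 1
          then show ?thesis using x ge t' ex2 True by auto
        next
          case 2
          then have "t = 3 \<or> t \<ge> 5" using d2 t' by presburger
          then show ?thesis using 2 x ge ex3 True by auto
        next
          case 3
          then have "t \<ge> 7" using d2 d3 t' by presburger
          then show ?thesis using 3 x ge by linarith
        next
          case 4
          then have "t \<ge> 3 * k" using d4 t' by linarith
          then show ?thesis using 4 x ge by linarith
        qed
      next
        case False
        then have q3: "q \<ge> 3" "l \<le> q" using q2 lq by auto
        consider "k = 1" | "k = 2" | "k = 3" | "k \<ge> 4" using k_cases by blast
        then show ?thesis
        proof cases
          case 1
          then show ?thesis using mono[OF t'] ge eq q3 by linarith
        next
          case 2
          then have "t \<ge> 3" using d2 t' by presburger
          from mono[OF this] show ?thesis using 2 ge eq q3 by linarith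
        next
          case 3
          then have "t \<ge> 7" using d2 d3 t' by presburger
          from mono[OF this] show ?thesis using 3 ge eq q3 by linarith
        next
          case 4
          then have "t \<ge> k + 1" using d4 t' by linarith
          from mono[OF this] have "k * q + q \<le> t * q" by (simp add: distrib_right)
          moreover have "k * q \<ge> k * 3" using k q3 by simp
          ultimately show ?thesis using 4 ge eq q3 by linarith
        qed
      qed
    qed
  qed
qed

text \<open>Strong induction on \<open>m\<close>: the initial run of \<open>k\<close> unit steps is
  cut off and the rescaled tail has length \<open>m - k < m\<close>.\<close>

lemma nil_orbit_length_le:
  assumes "nil_orbit a m" "m \<ge> 1" "a 1 = a 0 + 1"
  shows "int m \<le> orbit_bound (a 0)"
  using assms
proof (induction m arbitrary: a rule: less_induct)
  case (less m)
  note orb = less.prems(1)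
  have a0: "a 0 \<noteq> 0" using nil_orbit_nonzero[OF orb, of 0] less.prems by simp
  show ?case
  proof (cases "\<forall>i\<le>m. a i = a 0 + int i")
    case True
    then have "a m = a 0 + int m" by blast
    then have "a 0 = - int m" using nil_orbit_end[OF orb] by simp
    then show ?thesis using less.prems(2) by (simp add: orbit_bound_def)
  next
    case False
    then obtain n where n: "n \<le> m" "a n \<noteq> a 0 + int n"
      "\<And>i. i < n \<Longrightarrow> a i = a 0 + int i"
      using exists_least_iff[of "\<lambda>i. i \<le> m \<and> a i \<noteq> a 0 + int i"] by (metis le_trans less_imp_le)
    have "n \<noteq> 0" "n \<noteq> 1" using n(2) less.prems(3) by (auto intro: ccontr)
    define k where "k = n - 1"
    have k: "k \<ge> 1" "k < m" and nk: "n = Suc k"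
      using n(1) \<open>n \<noteq> 0\<close> \<open>n \<noteq> 1\<close> by (auto simp: k_def)
    have run: "a i = a 0 + int i" if "i \<le> k" for i using n(3)[of i] that nk by simp
    obtain t b where tb: "t \<noteq> 0" "t = a (Suc k) - a k"
      "\<And>i. i \<le> m - k \<Longrightarrow> a (k + i) = t * b i" "b 1 = b 0 + 1" "nil_orbit b (m - k)"
      using nil_orbit_rescale[OF orb k(2)] by metis
    define q where "q = b 0"
    have ak: "a k = t * q" "a k = a 0 + int k" using tb(3)[of 0] run[of k] by (auto simp: q_def)
    have aSk: "a (Suc k) = t * q + t" using tb(2) ak by simp
    have t_ne_1: "t \<noteq> 1" using n(2) nk ak aSk by auto
    have "a (Suc k) \<noteq> a (k - 1)"
      using nil_orbit_no_repeat[OF orb, of "k - 1" "Suc k"] k by fastforce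
    moreover have ak1: "a (k - 1) = t * q - 1" using run[of "k - 1"] ak k by simp
    ultimately have t: "t \<notin> {-1, 0, 1}" using aSk tb(1) t_ne_1 by auto
    have q0: "q \<noteq> 0" using nil_orbit_nonzero[OF tb(5), of 0] k by (simp add: q_def)
    \<comment> \<open>Comparing indices \<open>k\<close> and \<open>k - j\<close> shows that
      \<open>j\<close> divides \<open>t - 1 + j\<close>.\<close>
    have run_dvd: "int j dvd t - 1" if j: "j \<ge> 1" "j \<le> k" for j
    proof -
      have "a k - a (k - j) dvd a (Suc k) - a (Suc (k - j))"
        using nil_orbit_dvd[OF orb] k by simp
      moreover have "a k - a (k - j) = int j" using run[of "k - j"] j ak by simp
      moreover have "a (Suc k) - a (Suc (k - j)) = (t - 1) + int j"
        using run[of "Suc (k - j)"] j ak aSk by simp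
      ultimately show ?thesis by simp
    qed
    \<comment> \<open>The coprime numbers \<open>k\<close> and \<open>k - 1 \<ge> 3\<close> both
      divide \<open>t - 1\<close>, hence so does their product.\<close>
    have big: "3 * int k \<le> \<bar>t - 1\<bar>" if "4 \<le> int k"
    proof -
      have "1 \<le> k - 1" using that by simp
      moreover have "coprime (int k) (int (k - 1))"
        using k coprime_diff_one_right_nat[of k] by (simp add: coprime_int_iff del: of_nat_diff)
      ultimately have "int k * int (k - 1) dvd t - 1"
        using k by (intro divides_mult run_dvd) simp_all
      then have "int k * int (k - 1) \<le> \<bar>t - 1\<bar>"
        using dvd_imp_le_int[of "t - 1" "int k * int (k - 1)"] t_ne_1 by simp
      moreover have "3 * int k \<le> int k * int (k - 1)" using that by simp
      ultimately show ?thesis by linarith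
    qed
    have len: "int (m - k) \<le> orbit_bound q"
      using less.IH[of "m - k" b] k tb(4,5) by (simp add: q_def)
    have bq: "b 0 = q" "b 1 = q + 1" using tb(4) by (auto simp: q_def)
    have ab: "a (Suc (Suc k)) = t * b 2" "b 2 - (q + 1) dvd q + 1" "b 2 \<noteq> q"
      if "Suc k < m"
    proof -
      have "2 \<le> m - k" "1 < m - k" using that by simp_all
      then show "a (Suc (Suc k)) = t * b 2" "b 2 - (q + 1) dvd q + 1" "b 2 \<noteq> q"
        using tb(3)[of 2] nil_orbit_step_dvd_value[OF tb(5), of 1 1]
          nil_orbit_no_repeat[OF tb(5), of 0 2] bq by (auto simp: numeral_2_eq_2)
    qed
    have Suc_k_less: "Suc k < m" if "t * q + t \<noteq> 0"
      using that k aSk nil_orbit_end[OF orb] by (cases "Suc k = m") auto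
    \<comment> \<open>excludes the orbit segment \<open>t - 1, t, 2t\<close>\<close>
    have ex1: "\<not> (q = 1 \<and> t \<ge> 2)"
    proof
      assume *: "q = 1 \<and> t \<ge> 2"
      have "nil_orbit (\<lambda>i. a (k - 1 + i)) (m - (k - 1))"
        using nil_orbit_shift[OF orb, of "k - 1"] k by simp
      moreover have "a (k - 1 + 0) = t - 1" "a (k - 1 + 1) = t" "a (k - 1 + 2) = 2 * t"
        using * ak ak1 aSk k by auto
      ultimately show False using nil_orbit_no_doubling * k by fastforce
    qed
    \<comment> \<open>excludes the orbit segment \<open>3, 4, 6\<close>\<close>
    have ex2: "\<not> (q = 2 \<and> t = 2 \<and> int k = 1)"
    proof
      assume *: "q = 2 \<and> t = 2 \<and> int k = 1"
      then have m: "Suc k < m" using Suc_k_less by simp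
      have "b 2 - 3 \<in> {-3,-1,1,3}" using ab(2)[OF m] dvd_3_cases[of "b 2 - 3"] * by simp
      then have "a 3 \<in> {0,8,12}" using ab(1,3)[OF m] * by (auto simp: numeral_3_eq_3)
      moreover have "a 2 - a 0 dvd a 3 - a 1"
        using nil_orbit_dvd[OF orb, of 2 0] * m by (simp add: numeral_eq_Suc)
      moreover have "a 2 = 6" "a 1 = 4" "a 0 = 3" using * ak aSk by (auto simp: numeral_2_eq_2)
      ultimately show False by auto
    qed
    \<comment> \<open>excludes the orbit segment \<open>4, 5, 6, 9\<close>\<close>
    have ex3: "\<not> (q = 2 \<and> t = 3 \<and> int k = 2)"
    proof
      assume *: "q = 2 \<and> t = 3 \<and> int k = 2"
      then have m: "Suc k < m" and k2: "k = 2" using Suc_k_less by simp_all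
      have "b 2 - 3 \<in> {-3,-1,1,3}" using ab(2)[OF m] dvd_3_cases[of "b 2 - 3"] * by simp
      then have b2: "b 2 \<in> {0,4,6}" using ab(3)[OF m] * by auto
      moreover have "a 4 = 3 * b 2" using ab(1)[OF m] * k2 by (simp add: numeral_eq_Suc)
      moreover have "a 3 - a 1 dvd a 4 - a 2"
        using nil_orbit_dvd[OF orb, of 3 1] k2 m by (simp add: numeral_eq_Suc)
      moreover have "a 3 = 9" "a 2 = 6" "a 1 = 5"
        using * ak aSk ak1 k2 by (auto simp: numeral_eq_Suc)
      ultimately have "b 2 = 6" by auto
      moreover have "2 \<le> m - k" using m by simp
      ultimately show False
        using nil_orbit_no_doubling[OF tb(5), of 3] bq * by simp
    qed
    \<comment> \<open>excludes the orbit segment \<open>-3, -2, -4\<close> with three further steps up to \<open>0\<close> after \<open>-2\<close>\<close>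
    have ex4: "int (m - k) \<le> 2" if "q = 1" "t = - 2" "int k = 1"
    proof (rule ccontr)
      assume "\<not> int (m - k) \<le> 2"
      then have m4: "m = 4" and k1: "k = 1" using len that by (auto simp: orbit_bound_def)
      have "b 2 - 2 \<in> {-2,-1,1,2}" using ab(2) dvd_2_cases[of "b 2 - 2"] that m4 k1 by simp
      then have "a 3 \<in> {0,-6,-8}" using ab(1,3) that m4 k1 by (auto simp: numeral_3_eq_3)
      moreover have "a 3 - a 0 dvd a 4 - a 1"
        using nil_orbit_dvd[OF orb, of 3 0] m4 by (simp add: numeral_eq_Suc)
      moreover have "a 4 = 0" "a 1 = -2" "a 0 = -3"
        using nil_orbit_end[OF orb] m4 ak k1 that by auto
      ultimately show False by auto
    qed
    have no_cross: "a 0 + int k < 0" if "a 0 < 0"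
    proof (rule ccontr)
      assume "\<not> a 0 + int k < 0"
      then have "nat (- a 0) \<le> k" "a 0 + int (nat (- a 0)) = 0" using that by auto
      then show False using run[of "nat (- a 0)"] nil_orbit_nonzero[OF orb, of "nat (- a 0)"] k by auto
    qed
    have "int k + int (m - k) \<le> orbit_bound (a 0)"
      by (rule orbit_bound_step[of "a 0" "int k" t q])
        (use ak k t q0 a0 no_cross run_dvd[of 2] run_dvd[of 3] big len ex1 ex2 ex3 ex4 in auto)
    then show ?thesis using k by simp
  qed
qed

lemma nil_orbit_length_le_abs:
  assumes "nil_orbit a m" "a 0 \<noteq> 0"
  shows "int m \<le> (if \<bar>a 0\<bar> = 1 then 3 else if \<bar>a 0\<bar> = 2 then 4 else \<bar>a 0\<bar>)"
proof -
  have m: "0 < m" using nil_orbit_end[OF assms(1)] assms(2) by (cases m) auto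
  obtain t b where tb: "t \<noteq> 0" "\<And>i. i \<le> m - 0 \<Longrightarrow> a (0 + i) = t * b i" "b 1 = b 0 + 1"
    "nil_orbit b (m - 0)"
    using nil_orbit_rescale[OF assms(1) m] by metis
  have le: "int m \<le> orbit_bound (b 0)" using nil_orbit_length_le[of b m] tb m by simp
  have a0: "\<bar>a 0\<bar> = \<bar>t\<bar> * \<bar>b 0\<bar>" using tb(2)[of 0] by (simp add: abs_mult)
  have t: "\<bar>t\<bar> = 1 \<or> \<bar>t\<bar> \<ge> 2" using tb(1) by auto
  have b0: "b 0 \<noteq> 0" using a0 assms(2) by auto
  have bt: "\<bar>b 0\<bar> \<le> \<bar>a 0\<bar>" using a0 tb(1) mult_right_mono[of 1 "\<bar>t\<bar>" "\<bar>b 0\<bar>"] by simp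
  consider "\<bar>b 0\<bar> = 1" | "\<bar>b 0\<bar> = 2" | "\<bar>b 0\<bar> \<ge> 3" using b0 by linarith
  then show ?thesis
  proof cases
    case 1
    then have "int m \<le> 3" using le by (auto simp: orbit_bound_def split: if_splits)
    then show ?thesis using assms(2) by auto
  next
    case 2
    then have "int m \<le> 4" using le by (auto simp: orbit_bound_def split: if_splits)
    \<comment> \<open>\<open>\<bar>a 0\<bar>\<close> is \<open>2\<close> or at least
      \<open>4\<close>; the value \<open>3\<close>, whose bound is below \<open>4\<close>, cannot
      occur.\<close>
    then show ?thesis using a0 2 t by auto
  next
    case 3
    then have "int m \<le> \<bar>b 0\<bar>" using le by (auto simp: orbit_bound_def split: if_splits)
    then show ?thesis using bt 3 by auto
  qed
qed

section \<open>Orbits starting at 0\<close>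

text \<open>The orbit is periodic, so its steps divide each other cyclically and have equal absolute
  value. Without repeated values it cannot turn back, so for \<open>m \<ge> 3\<close> it would never
  return.\<close>

lemma return_to_0_length_le_2:
  fixes a :: "nat \<Rightarrow> int"
  assumes "a 0 = 0" "a m = 0" "\<And>i. 0 < i \<Longrightarrow> i < m \<Longrightarrow> a i \<noteq> 0"
    and dvd: "\<And>i j. a i - a j dvd a (Suc i) - a (Suc j)"
  shows "m \<le> 2"
proof (rule ccontr)
  assume "\<not> m \<le> 2"
  then have m: "m \<ge> 3" by simp
  have orb: "nil_orbit (\<lambda>i. a (Suc i)) (m - 1)"
    unfolding nil_orbit_def using assms m by auto
  define c where "c = a 1"
  have c: "c \<noteq> 0" using assms(3)[of 1] m by (simp add: c_def)
  have mono: "a (Suc i) - a i dvd a (Suc j) - a j" if "i \<le> j" for i j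
    using that
  proof (induction j rule: dec_induct)
    case (step n)
    then show ?case using dvd[of "Suc n" n] by (meson dvd_trans)
  qed simp
  have "a (Suc m) = a 1" using dvd[of m 0] assms(1,2) by simp
  then have "a (Suc i) - a i dvd c" if "i \<le> m" for i
    using mono[OF that] assms(2) by (simp add: c_def)
  moreover have "c dvd a (Suc i) - a i" for i
    using mono[of 0 i] assms(1) by (simp add: c_def)
  ultimately have step: "\<bar>a (Suc i) - a i\<bar> = \<bar>c\<bar>" if "i \<le> m" for i
    using that zdvd_antisym_abs by blast
  have "a i = int i * c \<and> a (Suc i) = int (Suc i) * c" if "i < m" for i
    using that
  proof (induction i)
    case 0
    then show ?case using assms(1) by (simp add: c_def)
  next
    case (Suc i)
    \<comment> \<open>The initial \<open>0\<close> is not part of \<open>orb\<close>, so turning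
      back to it is excluded separately.\<close>
    have "a (Suc (Suc i)) \<noteq> a i"
    proof (cases i)
      case 0
      then show ?thesis using assms(1) assms(3)[of 2] m by (simp add: numeral_2_eq_2)
    next
      case (Suc i')
      then show ?thesis
        using nil_orbit_no_repeat[OF orb, of i' "Suc i"] \<open>Suc i < m\<close> m by fastforce
    qed
    then have "a (Suc (Suc i)) - a (Suc i) = c"
      using step[of "Suc i"] Suc by (auto simp: abs_eq_iff algebra_simps)
    then show ?case using Suc by (simp add: algebra_simps)
  qed
  from this[of "m - 1"] have "int m * c = 0" using m assms(2) by simp
  then show False using c m by simp
qed

section \<open>From polynomials to their orbits\<close>

lemma diff_dvd_poly_diff:
  fixes p :: "'a::comm_ring_1 poly"
  shows "x - y dvd poly p x - poly p y"
proof (induction p)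
  case (pCons c p)
  have "poly (pCons c p) x - poly (pCons c p) y
      = x * (poly p x - poly p y) + (x - y) * poly p y"
    by (simp add: algebra_simps)
  then show ?case using pCons by simp
qed simp

lemma poly_poly_iterate: "poly (poly_iterate u n) x = (poly u ^^ n) x"
  unfolding poly_iterate_def by (induction n) (simp_all add: poly_pcompose)

text \<open>Trades composed polynomials and \<open>LEAST\<close> for iterates of the evaluation map,
  the form used from here on.\<close>

lemma nilpotent_polys_iff:
  assumes "m > 0"
  shows "u \<in> nilpotent_polys r m \<longleftrightarrow>
    (poly u ^^ m) r = 0 \<and> (\<forall>i. 0 < i \<and> i < m \<longrightarrow> (poly u ^^ i) r \<noteq> 0)"
proof
  assume u: "u \<in> nilpotent_polys r m"
  then have ex: "\<exists>n. n > 0 \<and> poly (poly_iterate u n) r = 0"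
    and least: "(LEAST n. n > 0 \<and> poly (poly_iterate u n) r = 0) = m"
    by (auto simp: nilpotent_polys_def nilpotent_at_def nilpotency_index_def)
  show "(poly u ^^ m) r = 0 \<and> (\<forall>i. 0 < i \<and> i < m \<longrightarrow> (poly u ^^ i) r \<noteq> 0)"
    using LeastI_ex[OF ex] not_less_Least[of _ "\<lambda>n. n > 0 \<and> poly (poly_iterate u n) r = 0"]
    unfolding least by (auto simp: poly_poly_iterate)
next
  assume *: "(poly u ^^ m) r = 0 \<and> (\<forall>i. 0 < i \<and> i < m \<longrightarrow> (poly u ^^ i) r \<noteq> 0)"
  then have "(LEAST n. n > 0 \<and> poly (poly_iterate u n) r = 0) = m"
    using assms by (intro Least_equality) (auto simp: poly_poly_iterate intro: leI)
  then show "u \<in> nilpotent_polys r m"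
    using * assms
    by (auto simp: nilpotent_polys_def nilpotent_at_def nilpotency_index_def poly_poly_iterate)
qed

lemma nilpotent_polys_index_le:
  assumes "m > 0" "u \<in> nilpotent_polys r m"
  shows "m \<le> (if r = 0 then 2 else if \<bar>r\<bar> = 1 then 3 else if \<bar>r\<bar> = 2 then 4 else nat \<bar>r\<bar>)"
proof -
  define a where "a = (\<lambda>i. (poly u ^^ i) r)"
  have a: "a 0 = r" "a m = 0" "\<And>i. 0 < i \<Longrightarrow> i < m \<Longrightarrow> a i \<noteq> 0"
    using assms nilpotent_polys_iff by (auto simp: a_def)
  have dvd: "a i - a j dvd a (Suc i) - a (Suc j)" for i j
    by (simp add: a_def diff_dvd_poly_diff)
  show ?thesis
  proof (cases "r = 0")
    case True
    then show ?thesis using return_to_0_length_le_2[of a m] a dvd by simp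
  next
    case False
    then have "a i \<noteq> 0" if "i < m" for i using a that by (cases i) auto
    then have "nil_orbit a m" using a dvd by (simp add: nil_orbit_def)
    then show ?thesis using nil_orbit_length_le_abs[of a m] a False by (auto split: if_splits)
  qed
qed

section \<open>Polynomials attaining the bound\<close>

lemma nilpotent_polys_nonempty:
  "nilpotent_polys r (if r = 0 then 2 else if \<bar>r\<bar> = 1 then 3 else if \<bar>r\<bar> = 2 then 4 else nat \<bar>r\<bar>) \<noteq> {}"
proof -
  consider "r = 0" | "r = 1" | "r = -1" | "r = 2" | "r = -2" | "\<bar>r\<bar> \<ge> 3" by linarith
  then show ?thesis
  proof cases
    case 1
    \<comment> \<open>Orbit \<open>0, 1, 0\<close>.\<close>
    have "[:1, -1:] \<in> nilpotent_polys r 2"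
      using 1 by (auto simp: nilpotent_polys_iff numeral_eq_Suc less_Suc_eq)
    then show ?thesis using 1 by auto
  next
    case 2
    \<comment> \<open>orbit \<open>1, 2, 3, 0\<close>; the case \<open>r = - 1\<close> is its mirror image under negation\<close>
    have "[:-3, 7, -2:] \<in> nilpotent_polys r 3"
      using 2 by (auto simp: nilpotent_polys_iff eval_nat_numeral less_Suc_eq)
    then show ?thesis using 2 by auto
  next
    case 3
    have "[:3, 7, 2:] \<in> nilpotent_polys r 3"
      using 3 by (auto simp: nilpotent_polys_iff eval_nat_numeral less_Suc_eq)
    then show ?thesis using 3 by auto
  next
    case 4
    \<comment> \<open>orbit \<open>2, 3, 4, 5, 0\<close>, likewise mirrored for \<open>r = - 2\<close>\<close>
    have "[:25, -25, 9, -1:] \<in> nilpotent_polys r 4"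
      using 4 by (auto simp: nilpotent_polys_iff eval_nat_numeral less_Suc_eq)
    then show ?thesis using 4 by auto
  next
    case 5
    have "[:-25, -25, -9, -1:] \<in> nilpotent_polys r 4"
      using 5 by (auto simp: nilpotent_polys_iff eval_nat_numeral less_Suc_eq)
    then show ?thesis using 5 by auto
  next
    case 6
    \<comment> \<open>Unit steps towards \<open>0\<close> take exactly \<open>\<bar>r\<bar>\<close>
      iterations.\<close>
    have "(poly [:- sgn r, 1:] ^^ i) r = sgn r * (\<bar>r\<bar> - int i)" for i
      by (induction i) (simp_all add: algebra_simps abs_mult_sgn)
    then have "[:- sgn r, 1:] \<in> nilpotent_polys r (nat \<bar>r\<bar>)"
      using 6 by (auto simp: nilpotent_polys_iff sgn_eq_0_iff)
    then show ?thesis using 6 by auto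
  qed
qed

theorem mainTheorem3:
  fixes r :: int
  shows "(\<exists>m::nat. m > 0 \<and> nilpotent_polys r m \<noteq> {} \<and>
            (\<forall>k::nat. k > 0 \<and> nilpotent_polys r k \<noteq> {} \<longrightarrow> k \<le> m)) \<and>
         m_max r = (if r = 0 then 2
                    else if \<bar>r\<bar> = 1 then 3
                    else if \<bar>r\<bar> = 2 then 4
                    else nat \<bar>r\<bar>)"
proof -
  define M where
    "M = (if r = 0 then 2 else if \<bar>r\<bar> = 1 then 3 else if \<bar>r\<bar> = 2 then 4 else nat \<bar>r\<bar>)"
  have M: "M > 0" "nilpotent_polys r M \<noteq> {}"
    and max: "\<And>k. k > 0 \<and> nilpotent_polys r k \<noteq> {} \<Longrightarrow> k \<le> M"
    using nilpotent_polys_nonempty[of r] nilpotent_polys_index_le[of _ _ r]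
    by (auto simp: M_def)
  have "m_max r = M"
    unfolding m_max_def using M max by (intro Greatest_equality) auto
  then show ?thesis using M max unfolding M_def[symmetric] by blast
qed

end
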